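(* Let $k$ be a positive integer and let $D=\{2,4,6k+1\}$. The winner for $D$ is the set whose indicator string is $$S^*=(110000)^k\,100100\,100100\,100100\cdots,$$ i.e. the string consisting of $k$ copies of $110000$ followed by infinitely many copies of $100100$.
   Context: $\mathbb{N}=\{0,1,2,\dots\}$. For $S\subseteq\mathbb{N}$ put $S_q=\sum_{n\in S}q^n$ for $q\in(0,1)$. For $S,S'\subseteq\mathbb{N}$ write $S'\preceq S$ (the germ order) iff there exists $\epsilon>0$ such that $S'_q\le S_q$ for all $q\in(1-\epsilon,1)$. A set $S\subseteq\mathbb{N}$ is $D$-avoiding if no two elements of $S$ differ by an element of $D$. A $D$-avoiding set $S$ is the winner for $D$ if $S'\preceq S$ for every $D$-avoiding set $S'\subseteq\mathbb{N}$. An infinite bit string $b_0b_1b_2\cdots$ is identified with the set $\{n\in\mathbb{N}: b_n=1\}$. Juxtaposition denotes concatenation and $(\cdot)^k$ denotes $k$-fold repetition. *)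

theory Defs
  imports "HOL-Analysis.Analysis" "HOL-Library.Stream" "HOL-Library.Z2"
begin

definition gen_fun :: "nat set \<Rightarrow> real \<Rightarrow> real" where
  "gen_fun S q = (\<Sum>\<^sub>\<infinity>n\<in>S. q ^ n)"

text \<open>
  Only values of \<open>q\<close> in \<open>(0,1)\<close> are meaningful. Allowing \<open>\<epsilon> > 1\<close> below is harmless,
  since any witness can be replaced by a smaller one.
\<close>

definition germ_le :: "nat set \<Rightarrow> nat set \<Rightarrow> bool"  (infix "\<preceq>" 50) where
  "S' \<preceq> S \<longleftrightarrow> (\<exists>\<epsilon>>0. \<forall>q\<in>{1 - \<epsilon><..<1}. gen_fun S' q \<le> gen_fun S q)"

definition avoiding :: "nat set \<Rightarrow> nat set \<Rightarrow> bool" where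
  "avoiding D S \<longleftrightarrow> (\<forall>m\<in>S. \<forall>n\<in>S. m < n \<longrightarrow> n - m \<notin> D)"

definition is_winner :: "nat set \<Rightarrow> nat set \<Rightarrow> bool" where
  "is_winner D S \<longleftrightarrow> avoiding D S \<and> (\<forall>S'. avoiding D S' \<longrightarrow> S' \<preceq> S)"

definition set_of_bits :: "bit stream \<Rightarrow> nat set" where
  "set_of_bits b = {n. b !! n = 1}"

definition winner_bits :: "nat \<Rightarrow> bit stream" where
  "winner_bits k = concat (replicate k [1,1,0,0,0,0]) @- cycle [1,0,0,1,0,0]"

end

theory Submission
  imports Defs
begin

text \<open>
  Write \<open>W\<close> for the claimed winner. Since 2 and 4 are forbidden differences, the even elements of
  an avoiding set are at distance at least 6 from each other, and so are the odd ones. Each of the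
  two parity classes is therefore dominated by a progression of step 6, and the ideal, with
  generating function \<open>(1 + q) / (1 - q^6)\<close>, would be to take all \<open>6j\<close> and all \<open>6j + 1\<close>. The
  difference \<open>6k + 1\<close> between \<open>0\<close> and \<open>6k + 1\<close> rules this out, so some class has to leave its
  progression.

  When a class living in \<open>[c, \<infinity>)\<close> first misses a point \<open>c + 6i\<close> of its progression (a
  \<^emph>\<open>slip\<close>), everything after that lives in \<open>[c + 6i + 2, \<infinity>)\<close>. Measured against the ideal, this
  costs exactly \<open>q^(c + 6i) * r\<close> with \<open>r = (1 - q^2) / (1 - q^6)\<close>, plus whatever the remaining
  part loses against the progression starting at \<open>c + 6i + 2\<close> (\<open>deficit_slip\<close>). The remaining
  part can again be treated in the same way.

  The set \<open>W\<close> has a single slip, in the odd class at \<open>6k + 1\<close>, and so a deficit of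
  \<open>q^(6k + 1) * r\<close>. Let \<open>S\<close> be another avoiding set. If the even class of \<open>S\<close> never slips, then
  \<open>0 \<in> S\<close> excludes \<open>6k + 1\<close>, so the odd class slips at some \<open>6i + 1\<close> with \<open>i \<le> k\<close>; the cost is
  larger than that of \<open>W\<close> if \<open>i < k\<close>, and if \<open>i = k\<close> there must be a further slip. If the even
  class slips but the odd class does not, then \<open>1\<close> and \<open>6k + 1\<close> are in \<open>S\<close>, which excludes
  \<open>6k + 2\<close> and \<open>0\<close>; hence the even class slips immediately and then once more. If both classes
  slip, there are again two slips. Two slips cost at least \<open>(q^N + q^M) * r\<close>, and as
  \<open>q^N + q^M \<longrightarrow> 2\<close> for \<open>q \<longrightarrow> 1\<close> this exceeds \<open>q^(6k + 1) * r\<close> near 1 (\<open>two_slips_beat_one\<close>).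

  So every other avoiding set is strictly worse than \<open>W\<close> near 1 (\<open>gen_fun_less_winner\<close>). This
  gives both that \<open>W\<close> is a winner and that it is the only one.
\<close>

section \<open>Progressions of step 6, tracks and deficits\<close>

definition prog :: "nat \<Rightarrow> nat set" where
  "prog c = range (\<lambda>j. c + 6 * j)"

text \<open>
  A track is what a parity class of an avoiding set looks like from \<open>c\<close> on; \<open>c\<close> fixes both the
  parity and the first position that may be used.
\<close>
definition track :: "nat \<Rightarrow> nat set \<Rightarrow> bool" where
  "track c A \<longleftrightarrow> (\<forall>n\<in>A. c \<le> n \<and> even (n - c)) \<and> avoiding {2, 4} A"

text \<open>
  The first term is the generating function of \<open>prog c\<close>, which is the largest possible one for a
  track starting at \<open>c\<close>.
\<close>
definition deficit :: "nat \<Rightarrow> nat set \<Rightarrow> real \<Rightarrow> real" where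
  "deficit c A q = q ^ c / (1 - q ^ 6) - gen_fun A q"

text \<open>
  Delaying a full progression by 2, from \<open>prog c\<close> to \<open>prog (c + 2)\<close>, costs \<open>q ^ c\<close> times this
  amount.
\<close>
definition slip_cost :: "real \<Rightarrow> real" where
  "slip_cost q = (1 - q ^ 2) / (1 - q ^ 6)"

lemma mem_prog: "n \<in> prog c \<longleftrightarrow> c \<le> n \<and> n mod 6 = c mod 6"
proof
  assume "n \<in> prog c"
  then show "c \<le> n \<and> n mod 6 = c mod 6" by (auto simp: prog_def)
next
  assume n: "c \<le> n \<and> n mod 6 = c mod 6"
  then obtain j where "n - c = 6 * j"
    using mod_eq_dvd_iff_nat[of c n 6] unfolding dvd_def by blast
  moreover have "n = c + (n - c)" using n by (intro le_add_diff_inverse[symmetric]) blast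
  ultimately show "n \<in> prog c" unfolding prog_def by (metis rangeI)
qed

lemma prog_member: "c + 6 * j \<in> prog c"
  by (simp add: prog_def)

lemma avoiding_mono: "avoiding D S \<Longrightarrow> A \<subseteq> S \<Longrightarrow> D' \<subseteq> D \<Longrightarrow> avoiding D' A"
  unfolding avoiding_def by blast

lemma powers_summable_on:
  fixes q :: real
  assumes "0 < q" "q < 1"
  shows "(\<lambda>n. q ^ n) summable_on A"
proof -
  have "(\<lambda>n. q ^ n) summable_on UNIV"
    using assms by (intro summable_nonneg_imp_summable_on summable_geometric) auto
  then show ?thesis
    using summable_on_subset_banach by blast
qed

lemma gen_fun_disjoint_Un:
  assumes "0 < q" "q < 1" "A \<inter> B = {}"
  shows "gen_fun (A \<union> B) q = gen_fun A q + gen_fun B q"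
  unfolding gen_fun_def using assms by (intro infsum_Un_disjoint powers_summable_on)

lemma gen_fun_prog:
  assumes "0 < q" "q < 1"
  shows "gen_fun (prog c) q = q ^ c / (1 - q ^ 6)"
proof -
  have q6: "norm (q ^ 6) < 1"
    using assms by (simp add: power_less_one_iff abs_if)
  have "(\<lambda>j. q ^ c * (q ^ 6) ^ j) sums (q ^ c * (1 / (1 - q ^ 6)))"
    using geometric_sums[OF q6] by (intro sums_mult)
  then have "((\<lambda>j. q ^ c * (q ^ 6) ^ j) has_sum (q ^ c * (1 / (1 - q ^ 6)))) UNIV"
    using assms by (intro sums_nonneg_imp_has_sum) auto
  then have "(\<Sum>\<^sub>\<infinity>j. q ^ c * (q ^ 6) ^ j) = q ^ c / (1 - q ^ 6)"
    by (simp add: infsumI)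
  moreover have "gen_fun (prog c) q = (\<Sum>\<^sub>\<infinity>j. q ^ c * (q ^ 6) ^ j)"
    unfolding gen_fun_def prog_def
    by (subst infsum_reindex) (auto simp: inj_on_def o_def power_add power_mult)
  ultimately show ?thesis by simp
qed

lemma deficit_prog: "0 < q \<Longrightarrow> q < 1 \<Longrightarrow> deficit c (prog c) q = 0"
  by (simp add: deficit_def gen_fun_prog)

lemma slip_cost_pos:
  assumes "0 < q" "q < 1"
  shows "slip_cost q > 0"
  using assms by (simp add: slip_cost_def power_less_one_iff)

lemma track_close_eq:
  assumes "track c A" "m \<in> A" "n \<in> A" "m \<le> n" "n < m + 6"
  shows "m = n"
proof (rule ccontr)
  assume "m \<noteq> n"
  then have "m < n" using assms by simp
  have "c \<le> m" "even (m - c)" "even (n - c)"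
    using assms(1-3) unfolding track_def by blast+
  then have "n - m = 2 \<or> n - m = 4"
    using \<open>m < n\<close> \<open>n < m + 6\<close> by presburger
  then have "n - m \<in> {2, 4}"
    by simp
  then show False
    using assms \<open>m < n\<close> unfolding track_def avoiding_def by blast
qed

lemma block_start:
  fixes c n :: nat
  assumes "c \<le> n"
  shows "c + 6 * ((n - c) div 6) \<le> n" "n < c + 6 * ((n - c) div 6) + 6"
proof -
  obtain d where d: "n = c + d" using assms le_Suc_ex by blast
  have "6 * (d div 6) \<le> d" "d < 6 * (d div 6) + 6" by presburger+
  then show "c + 6 * ((n - c) div 6) \<le> n" "n < c + 6 * ((n - c) div 6) + 6"
    unfolding d by simp_all
qed

text \<open>
  Cutting \<open>[c, \<infinity>)\<close> into blocks of length 6, each block holds at most one element of the track.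
  Moving every element down to the start of its block only increases the generating function,
  and the result is a subset of the progression.
\<close>
lemma deficit_nonneg:
  assumes "track c A" and q: "0 < q" "q < 1"
  shows "deficit c A q \<ge> 0"
proof -
  define f where "f n = c + 6 * ((n - c) div 6)" for n
  have le: "f n \<le> n" and lt: "n < f n + 6" if "n \<in> A" for n
  proof -
    have "c \<le> n" using assms(1) that unfolding track_def by blast
    then show "f n \<le> n" "n < f n + 6" unfolding f_def by (rule block_start)+
  qed
  have inj: "inj_on f A"
  proof (rule inj_onI)
    fix m n assume mn: "m \<in> A" "n \<in> A" "f m = f n"
    show "m = n"
      using track_close_eq[OF assms(1), of m n] track_close_eq[OF assms(1), of n m]
        mn le[of m] le[of n] lt[of m] lt[of n] by linarith
  qed
  have "gen_fun A q \<le> (\<Sum>\<^sub>\<infinity>n\<in>A. q ^ f n)"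
    unfolding gen_fun_def
  proof (rule infsum_mono)
    have "(\<lambda>n. q ^ n) summable_on (f ` A)" by (rule powers_summable_on[OF q])
    then show "(\<lambda>n. q ^ f n) summable_on A"
      using inj by (simp add: summable_on_reindex o_def)
  qed (use q le in \<open>auto intro: powers_summable_on power_decreasing\<close>)
  also have "\<dots> = gen_fun (f ` A) q"
    unfolding gen_fun_def using inj by (simp add: infsum_reindex o_def)
  also have "\<dots> \<le> gen_fun (prog c) q"
    unfolding gen_fun_def using q
    by (intro infsum_mono_neutral powers_summable_on) (auto simp: f_def prog_def)
  finally show ?thesis
    using q by (simp add: deficit_def gen_fun_prog)
qed

section \<open>Slips\<close>

lemma track_before_slip:
  assumes "track c A" "\<And>j. j < i \<Longrightarrow> c + 6 * j \<in> A"
  shows "A \<inter> {..<c + 6 * i} = prog c \<inter> {..<c + 6 * i}"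
proof (intro set_eqI iffI)
  fix n assume n: "n \<in> A \<inter> {..<c + 6 * i}"
  define j where "j = (n - c) div 6"
  have "c \<le> n" using n assms(1) unfolding track_def by blast
  then have j: "c + 6 * j \<le> n" "n < c + 6 * j + 6"
    unfolding j_def by (rule block_start)+
  then have "j < i" using n by simp
  then have "c + 6 * j = n"
    using track_close_eq[OF assms(1) _ _ j] n assms(2) by blast
  then show "n \<in> prog c \<inter> {..<c + 6 * i}"
    using n by (auto simp: prog_def)
qed (use assms(2) in \<open>auto simp: prog_def\<close>)

lemma slip_exists:
  assumes "track c A" "A \<noteq> prog c"
  obtains i where "c + 6 * i \<notin> A" "\<And>j. j < i \<Longrightarrow> c + 6 * j \<in> A"
proof -
  have "\<exists>i. c + 6 * i \<notin> A"
  proof (rule ccontr)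
    assume *: "\<nexists>i. c + 6 * i \<notin> A"
    have "n \<in> A \<longleftrightarrow> n \<in> prog c" for n
      using track_before_slip[OF assms(1), of "Suc n"] * by auto
    then show False using assms(2) by blast
  qed
  then show ?thesis
    using that exists_least_iff[of "\<lambda>i. c + 6 * i \<notin> A"] by blast
qed

lemma track_after_slip:
  assumes "track c A" "c + 6 * i \<notin> A"
  shows "track (c + 6 * i + 2) (A \<inter> {c + 6 * i..})"
proof -
  have "c + 6 * i + 2 \<le> n \<and> even (n - (c + 6 * i + 2))" if "n \<in> A" "c + 6 * i \<le> n" for n
  proof -
    have "even (n - c)" "n \<noteq> c + 6 * i"
      using assms that unfolding track_def by blast+
    then show ?thesis using that(2) by presburger
  qed
  then show ?thesis
    using assms(1) avoiding_mono[of "{2,4}" A] unfolding track_def by auto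
qed

text \<open>
  Before \<open>c + 6i\<close> the track and the progression agree, so the comparison may start at \<open>c + 6i\<close>;
  there the reference point jumps from \<open>c + 6i\<close> to \<open>c + 6i + 2\<close>, because the parity is fixed. This
  is an equality, so slips can be counted one after the other.
\<close>
lemma deficit_slip:
  assumes "track c A" "c + 6 * i \<notin> A" "\<And>j. j < i \<Longrightarrow> c + 6 * j \<in> A"
    and q: "0 < q" "q < 1"
  shows "deficit c A q =
    q ^ (c + 6 * i) * slip_cost q + deficit (c + 6 * i + 2) (A \<inter> {c + 6 * i..}) q"
proof -
  let ?m = "c + 6 * i"
  have split: "gen_fun B q = gen_fun (B \<inter> {..<?m}) q + gen_fun (B \<inter> {?m..}) q" for B
    by (subst gen_fun_disjoint_Un[OF q, symmetric]) (auto intro: arg_cong2[where f = gen_fun])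
  have "prog c \<inter> {?m..} = prog ?m"
    by (auto simp: mem_prog)
  then have "q ^ c / (1 - q ^ 6) - gen_fun A q
      = q ^ ?m / (1 - q ^ 6) - gen_fun (A \<inter> {?m..}) q"
    using split[of A] split[of "prog c"] track_before_slip[OF assms(1,3)]
    by (simp add: gen_fun_prog[OF q, symmetric])
  also have "\<dots> = q ^ ?m * slip_cost q + deficit (?m + 2) (A \<inter> {?m..}) q"
    unfolding slip_cost_def deficit_def
    by (simp add: power_add algebra_simps diff_divide_distrib power2_eq_square)
  finally show ?thesis by (simp add: deficit_def)
qed

lemma deficit_lower_bound:
  assumes "track c A" "A \<noteq> prog c"
  obtains N where "\<And>q. 0 < q \<Longrightarrow> q < 1 \<Longrightarrow> q ^ N * slip_cost q \<le> deficit c A q"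
proof -
  obtain i where i: "c + 6 * i \<notin> A" "\<And>j. j < i \<Longrightarrow> c + 6 * j \<in> A"
    using slip_exists[OF assms] by blast
  show ?thesis
    using that[of "c + 6 * i"] deficit_slip[OF assms(1) i]
      deficit_nonneg[OF track_after_slip[OF assms(1) i(1)]] by force
qed

section \<open>Splitting a set by parity\<close>

lemma track_parity_classes:
  assumes "avoiding D S" "{2, 4} \<subseteq> D"
  shows "track 0 (S \<inter> {n. even n})" "track 1 (S \<inter> {n. odd n})"
  using avoiding_mono[OF assms(1) _ assms(2), of "S \<inter> {n. even n}"]
    avoiding_mono[OF assms(1) _ assms(2), of "S \<inter> {n. odd n}"]
  unfolding track_def by (auto intro: Suc_leI odd_pos)

lemma gen_fun_eq_deficits:
  assumes "0 < q" "q < 1"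
  shows "gen_fun S q = (1 + q) / (1 - q ^ 6)
    - (deficit 0 (S \<inter> {n. even n}) q + deficit 1 (S \<inter> {n. odd n}) q)"
proof -
  have "S = (S \<inter> {n. even n}) \<union> (S \<inter> {n. odd n})" by blast
  then have "gen_fun S q = gen_fun (S \<inter> {n. even n}) q + gen_fun (S \<inter> {n. odd n}) q"
    using gen_fun_disjoint_Un[OF assms, of "S \<inter> {n. even n}" "S \<inter> {n. odd n}"] by auto
  then show ?thesis
    by (simp add: deficit_def add_divide_distrib)
qed

section \<open>The winning set\<close>

lemma snth_shift_block:
  "length xs = 6 \<Longrightarrow> (xs @- s) !! n = (if n < 6 then xs ! n else s !! (n - 6))"
  by (simp add: shift_snth_less shift_snth_ge)

lemma snth_cycle_block:
  assumes "length u = 6"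
  shows "cycle u !! n = u ! (n mod 6)"
proof -
  have "u \<noteq> []" using assms by auto
  then have "cycle u !! n = u ! (n mod length u)"
    by (simp add: sdrop_simps(1)[symmetric] sdrop_cycle hd_rotate_conv_nth del: sdrop_simps)
  then show ?thesis by (simp only: assms)
qed

lemma less_6_cases: "(n::nat) < 6 \<Longrightarrow> n = 0 \<or> n = 1 \<or> n = 2 \<or> n = 3 \<or> n = 4 \<or> n = 5"
  by linarith

lemma nth_block_early: "r < 6 \<Longrightarrow> [1,1,0,0,0,0] ! r = (1::bit) \<longleftrightarrow> r = 0 \<or> r = 1"
  by (drule less_6_cases, elim disjE) simp_all

lemma nth_block_late: "r < 6 \<Longrightarrow> [1,0,0,1,0,0] ! r = (1::bit) \<longleftrightarrow> r = 0 \<or> r = 3"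
  by (drule less_6_cases, elim disjE) simp_all

lemma mem_winner:
  "n \<in> set_of_bits (winner_bits k) \<longleftrightarrow>
    n mod 6 = 0 \<or> n mod 6 = 1 \<and> n < 6 * k \<or> n mod 6 = 3 \<and> 6 * k \<le> n"
proof (induction k arbitrary: n)
  case 0
  have "winner_bits 0 !! n = [1,0,0,1,0,0] ! (n mod 6)"
    using snth_cycle_block[of "[1,0,0,1,0,0]" n] by (simp add: winner_bits_def)
  then show ?case
    using nth_block_late[of "n mod 6"] by (simp add: set_of_bits_def)
next
  case (Suc k)
  have "winner_bits (Suc k) = [1,1,0,0,0,0] @- winner_bits k"
    by (simp add: winner_bits_def)
  then have step: "winner_bits (Suc k) !! n =
      (if n < 6 then [1,1,0,0,0,0] ! n else winner_bits k !! (n - 6))"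
    using snth_shift_block[of "[1,1,0,0,0,0]" "winner_bits k" n] by (simp del: shift.simps)
  show ?case
  proof (cases "n < 6")
    case True
    then have "n mod 6 = n" "n < 6 * Suc k" "\<not> 6 * Suc k \<le> n" by simp_all
    moreover have "n \<in> set_of_bits (winner_bits (Suc k)) \<longleftrightarrow> n = 0 \<or> n = 1"
      unfolding set_of_bits_def mem_Collect_eq step using True nth_block_early by simp
    ultimately show ?thesis by metis
  next
    case False
    then have ge: "6 \<le> n" by simp
    have "n \<in> set_of_bits (winner_bits (Suc k)) \<longleftrightarrow> n - 6 \<in> set_of_bits (winner_bits k)"
      unfolding set_of_bits_def mem_Collect_eq step using False by simp
    moreover have "(n - 6) mod 6 = n mod 6" using ge by (simp add: le_mod_geq)
    moreover have "n - 6 < 6 * k \<longleftrightarrow> n < 6 * Suc k" "6 * k \<le> n - 6 \<longleftrightarrow> 6 * Suc k \<le> n"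
      using ge by auto
    ultimately show ?thesis using Suc.IH[of "n - 6"] by metis
  qed
qed

lemma avoiding_winner: "avoiding {2, 4, 6 * k + 1} (set_of_bits (winner_bits k))"
  unfolding avoiding_def
proof (intro ballI impI notI)
  fix m n
  assume m: "m \<in> set_of_bits (winner_bits k)" and n: "n \<in> set_of_bits (winner_bits k)"
    and "m < n" "n - m \<in> {2, 4, 6 * k + 1}"
  let ?res = "\<lambda>r::nat. r = 0 \<or> r = 1 \<or> r = 3"
  have residue: "?res (i mod 6)" if "i \<in> set_of_bits (winner_bits k)" for i
    using that unfolding mem_winner by blast
  have add_2: "r = 1 \<and> s = 3" if "s = (r + 2) mod 6" "?res r" "?res s" for r s :: nat
    using that by (elim disjE) simp_all
  have add_4: "r = 3 \<and> s = 1" if "s = (r + 4) mod 6" "?res r" "?res s" for r s :: nat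
    using that by (elim disjE) simp_all
  have add_1: "r = 0 \<and> s = 1" if "s = (r + 1) mod 6" "?res r" "?res s" for r s :: nat
    using that by (elim disjE) simp_all
  from \<open>m < n\<close> \<open>n - m \<in> _\<close> consider "n = m + 2" | "n = m + 4" | "n = m + 1 + 6 * k" by force
  then show False
  proof cases
    case 1
    then have "n mod 6 = (m mod 6 + 2) mod 6" by (simp only: mod_simps)
    then have "m mod 6 = 1 \<and> n mod 6 = 3"
      using residue[OF m] residue[OF n] by (intro add_2)
    then have "m < 6 * k" "6 * k \<le> m + 2" using m n 1 unfolding mem_winner by simp_all
    then show False using \<open>m mod 6 = 1 \<and> n mod 6 = 3\<close> by presburger
  next
    case 2
    then have "n mod 6 = (m mod 6 + 4) mod 6" by (simp only: mod_simps)
    then have "m mod 6 = 3 \<and> n mod 6 = 1"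
      using residue[OF m] residue[OF n] by (intro add_4)
    then have "6 * k \<le> m" "n < 6 * k" using m n unfolding mem_winner by simp_all
    then show False using 2 by simp
  next
    case 3
    then have "n mod 6 = (m mod 6 + 1) mod 6" by (simp only: mod_simps mod_mult_self2)
    then have "m mod 6 = 0 \<and> n mod 6 = 1"
      using residue[OF m] residue[OF n] by (intro add_1)
    then have "n < 6 * k" using n unfolding mem_winner by simp
    then show False using 3 by simp
  qed
qed

lemma winner_even_part: "set_of_bits (winner_bits k) \<inter> {n. even n} = prog 0"
proof (intro set_eqI)
  fix n :: nat
  have "n mod 6 = 0 \<Longrightarrow> even n" "n mod 6 = 1 \<Longrightarrow> odd n" "n mod 6 = 3 \<Longrightarrow> odd n"
    by presburger+
  then show "n \<in> set_of_bits (winner_bits k) \<inter> {n. even n} \<longleftrightarrow> n \<in> prog 0"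
    by (auto simp: mem_winner mem_prog)
qed

lemma winner_odd_tail:
  "set_of_bits (winner_bits k) \<inter> {n. odd n} \<inter> {1 + 6 * k..} = prog (1 + 6 * k + 2)"
proof (intro set_eqI)
  fix n :: nat
  have eq: "1 + 6 * k + 2 = 3 + 6 * k" and "(3 + 6 * k) mod 6 = 3" by simp_all
  then have tail: "n \<in> prog (1 + 6 * k + 2) \<longleftrightarrow> 3 + 6 * k \<le> n \<and> n mod 6 = 3"
    unfolding mem_prog eq by simp
  have parity: "n mod 6 = 0 \<Longrightarrow> even n" "n mod 6 = 3 \<Longrightarrow> odd n" by presburger+
  have bound: "3 + 6 * k \<le> n" if "n mod 6 = 3" "6 * k \<le> n"
  proof -
    have "n = 6 * (n div 6) + 3" using div_mult_mod_eq[of n 6] that(1) by simp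
    then obtain j where "n = 6 * j + 3" by blast
    then have "k \<le> j" using that(2) by presburger
    then show ?thesis using \<open>n = 6 * j + 3\<close> by simp
  qed
  have lower: "1 + 6 * k \<le> n \<Longrightarrow> \<not> n < 6 * k" "3 + 6 * k \<le> n \<Longrightarrow> 1 + 6 * k \<le> n"
    "3 + 6 * k \<le> n \<Longrightarrow> 6 * k \<le> n"
    by simp_all
  show "n \<in> set_of_bits (winner_bits k) \<inter> {n. odd n} \<inter> {1 + 6 * k..}
      \<longleftrightarrow> n \<in> prog (1 + 6 * k + 2)"
    unfolding tail mem_winner Int_iff mem_Collect_eq atLeast_iff
    using parity bound lower by metis
qed

lemma one_plus_mod_6: "(1 + 6 * j) mod 6 = (1::nat)"
  by simp

lemma winner_odd_prefix: "j < k \<Longrightarrow> 1 + 6 * j \<in> set_of_bits (winner_bits k) \<inter> {n. odd n}"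
  unfolding mem_winner Int_iff mem_Collect_eq one_plus_mod_6 by simp

lemma winner_odd_slip: "1 + 6 * k \<notin> set_of_bits (winner_bits k) \<inter> {n. odd n}"
  unfolding mem_winner Int_iff mem_Collect_eq one_plus_mod_6 by simp

lemma gen_fun_winner:
  assumes "0 < q" "q < 1"
  shows "gen_fun (set_of_bits (winner_bits k)) q =
    (1 + q) / (1 - q ^ 6) - q ^ (6 * k + 1) * slip_cost q"
  using deficit_slip[OF track_parity_classes(2)[OF avoiding_winner] winner_odd_slip
      winner_odd_prefix assms] assms
  by (simp only: gen_fun_eq_deficits winner_even_part winner_odd_tail deficit_prog) simp

section \<open>Comparison near 1\<close>

lemma eventually_at_left_1_unit: "eventually (\<lambda>q::real. 0 < q \<and> q < 1) (at_left 1)"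
  by (auto simp: eventually_at_left_field intro: exI[of _ 0])

text \<open>
  As \<open>q\<close> tends to 1, the weight of a slip tends to 1 wherever it occurs, so two late slips
  eventually outweigh even one slip at position 0, whose weight is exactly 1.
\<close>
lemma two_slips_beat_one:
  assumes "\<And>q. 0 < q \<Longrightarrow> q < 1 \<Longrightarrow> (q ^ N + q ^ M) * slip_cost q \<le> d q"
  shows "eventually (\<lambda>q. q ^ L * slip_cost q < d q) (at_left 1)"
proof -
  have "((\<lambda>q::real. q ^ N + q ^ M) \<longlongrightarrow> 1 ^ N + 1 ^ M) (at_left 1)"
    by (intro tendsto_intros)
  then have "eventually (\<lambda>q::real. 1 < q ^ N + q ^ M) (at_left 1)"
    by (rule order_tendstoD) simp
  with eventually_at_left_1_unit show ?thesis
  proof eventually_elim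
    case (elim q)
    then have "q ^ L < q ^ N + q ^ M"
      by (meson le_less_trans less_imp_le power_le_one)
    then have "q ^ L * slip_cost q < (q ^ N + q ^ M) * slip_cost q"
      using slip_cost_pos elim by (intro mult_strict_right_mono) auto
    then show ?case using assms[of q] elim by linarith
  qed
qed

text \<open>
  The right-hand side is the total loss of \<open>S\<close> against the ideal \<open>(1 + q) / (1 - q^6)\<close>, the
  left-hand side is that of the winning set. The case distinction is on which of the two parity
  classes slip.
\<close>
lemma deficit_exceeds_winner:
  assumes S: "avoiding {2, 4, 6 * k + 1} S" and ne: "S \<noteq> set_of_bits (winner_bits k)"
  defines "E \<equiv> S \<inter> {n. even n}" and "Odd \<equiv> S \<inter> {n. odd n}"
  shows "eventually (\<lambda>q. q ^ (6 * k + 1) * slip_cost q < deficit 0 E q + deficit 1 Odd q)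
    (at_left 1)"
proof -
  have E: "track 0 E" and O: "track 1 Odd"
    unfolding E_def Odd_def using track_parity_classes[OF S] by auto
  have conflict: "n \<notin> S" if "m \<in> S" "n = m + (6 * k + 1)" for m n
    using S that unfolding avoiding_def by force
  show ?thesis
  proof (cases "E = prog 0")
    case True
    then have "0 + 6 * 0 \<in> E" using prog_member by blast
    then have "0 \<in> S" unfolding E_def by simp
    then have blocked: "1 + 6 * k \<notin> S" by (rule conflict) simp
    then have "Odd \<noteq> prog 1" unfolding Odd_def using prog_member by blast
    then obtain i where i: "1 + 6 * i \<notin> Odd" "\<And>j. j < i \<Longrightarrow> 1 + 6 * j \<in> Odd"
      using slip_exists[OF O] by blast
    have "i \<le> k"
      using i(2)[of k] blocked unfolding Odd_def by (meson IntD1 not_le)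
    \<comment> \<open>If the slip is no earlier than that of the winning set, the difference between the two
      sets lies after it, so the rest of the odd class has to slip again.\<close>
    let ?T = "Odd \<inter> {1 + 6 * i..}"
    have T: "track (1 + 6 * i + 2) ?T" by (rule track_after_slip[OF O i(1)])
    have strict: "i < k \<or> 0 < deficit (1 + 6 * i + 2) ?T q" if q: "0 < q" "q < 1" for q
    proof (rule ccontr)
      assume "\<not> ?thesis"
      then have "i = k" and "deficit (1 + 6 * i + 2) ?T q \<le> 0"
        using \<open>i \<le> k\<close> by auto
      have "?T = prog (1 + 6 * i + 2)"
      proof (rule ccontr)
        assume "?T \<noteq> prog (1 + 6 * i + 2)"
        then obtain N where "q ^ N * slip_cost q \<le> deficit (1 + 6 * i + 2) ?T q"
          using deficit_lower_bound[OF T] q by metis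
        moreover have "0 < q ^ N * slip_cost q" using q slip_cost_pos by simp
        ultimately show False
          using \<open>deficit (1 + 6 * i + 2) ?T q \<le> 0\<close> by linarith
      qed
      moreover have "Odd \<inter> {..<1 + 6 * k} =
          set_of_bits (winner_bits k) \<inter> {n. odd n} \<inter> {..<1 + 6 * k}"
        using track_before_slip[OF O i(2)] \<open>i = k\<close>
          track_before_slip[OF track_parity_classes(2)[OF avoiding_winner] winner_odd_prefix]
        by auto
      ultimately have "Odd = set_of_bits (winner_bits k) \<inter> {n. odd n}"
        using winner_odd_tail[of k] \<open>i = k\<close> by (simp add: set_eq_iff) (meson not_le)
      then have "S = set_of_bits (winner_bits k)"
        using True winner_even_part[of k] unfolding E_def Odd_def by blast
      then show False using ne by simp
    qed
    from eventually_at_left_1_unit show ?thesis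
    proof eventually_elim
      case (elim q)
      then have q: "0 < q" "q < 1" by auto
      have "q ^ (6 * k + 1) \<le> q ^ (1 + 6 * i)"
        using q \<open>i \<le> k\<close> by (intro power_decreasing) auto
      moreover have "q ^ (6 * k + 1) < q ^ (1 + 6 * i)" if "i < k"
        using q that by (intro power_strict_decreasing) auto
      ultimately show ?case
        using strict[OF q] deficit_nonneg[OF T q] deficit_nonneg[OF E q] slip_cost_pos[OF q]
          deficit_slip[OF O i q] mult_right_mono[of "q ^ (6 * k + 1)" "q ^ (1 + 6 * i)" "slip_cost q"]
          mult_strict_right_mono[of "q ^ (6 * k + 1)" "q ^ (1 + 6 * i)" "slip_cost q"]
        by linarith
    qed
  next
    case False
    show ?thesis
    proof (cases "Odd = prog 1")
      case odd_full: True
      \<comment> \<open>The even class misses 0 because of \<open>6k + 1\<close>, and then it cannot be all of \<open>prog 2\<close>,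
        because \<open>1\<close> blocks \<open>6k + 2\<close>: two slips, the first of them at position 0.\<close>
      then have "1 + 6 * k \<in> Odd" "1 + 6 * 0 \<in> Odd" using prog_member by blast+
      then have "1 + 6 * k \<in> S" "1 \<in> S" unfolding Odd_def by simp_all
      then have "0 \<notin> E" and blocked: "0 + 6 * 0 + 2 + 6 * k \<notin> S"
        using conflict[of 0 "1 + 6 * k"] conflict[of 1 "0 + 6 * 0 + 2 + 6 * k"]
        unfolding E_def by auto
      then have i: "0 + 6 * 0 \<notin> E" by simp
      have "E \<inter> {0 + 6 * 0..} \<noteq> prog (0 + 6 * 0 + 2)"
        using blocked prog_member unfolding E_def by blast
      then obtain N where "\<And>q. 0 < q \<Longrightarrow> q < 1 \<Longrightarrow>
          q ^ N * slip_cost q \<le> deficit (0 + 6 * 0 + 2) (E \<inter> {0 + 6 * 0..}) q"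
        using deficit_lower_bound[OF track_after_slip[OF E i]] by metis
      then show ?thesis
        using deficit_slip[OF E i] deficit_nonneg[OF O]
        by (intro two_slips_beat_one[of 0 N]) (fastforce simp: algebra_simps)
    next
      case odd_slips: False
      obtain N where "\<And>q. 0 < q \<Longrightarrow> q < 1 \<Longrightarrow> q ^ N * slip_cost q \<le> deficit 0 E q"
        using deficit_lower_bound[OF E False] by metis
      moreover obtain M where "\<And>q. 0 < q \<Longrightarrow> q < 1 \<Longrightarrow> q ^ M * slip_cost q \<le> deficit 1 Odd q"
        using deficit_lower_bound[OF O odd_slips] by metis
      ultimately show ?thesis
        by (intro two_slips_beat_one[of N M]) (simp add: distrib_right add_mono)
    qed
  qed
qed

lemma gen_fun_less_winner:
  assumes "avoiding {2, 4, 6 * k + 1} S" "S \<noteq> set_of_bits (winner_bits k)"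
  shows "eventually (\<lambda>q. gen_fun S q < gen_fun (set_of_bits (winner_bits k)) q) (at_left 1)"
  using deficit_exceeds_winner[OF assms] eventually_at_left_1_unit
  by eventually_elim (simp add: gen_fun_winner gen_fun_eq_deficits[of _ S])

section \<open>The germ order and the theorem\<close>

lemma germ_le_iff_eventually:
  "S' \<preceq> S \<longleftrightarrow> eventually (\<lambda>q. gen_fun S' q \<le> gen_fun S q) (at_left 1)"
proof
  assume "S' \<preceq> S"
  then obtain e where "e > 0" "\<forall>q\<in>{1 - e<..<1}. gen_fun S' q \<le> gen_fun S q"
    unfolding germ_le_def by blast
  then show "eventually (\<lambda>q. gen_fun S' q \<le> gen_fun S q) (at_left 1)"
    by (auto simp: eventually_at_left_field intro: exI[of _ "1 - e"])
next
  assume "eventually (\<lambda>q. gen_fun S' q \<le> gen_fun S q) (at_left 1)"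
  then obtain b where "b < 1" "\<forall>q>b. q < 1 \<longrightarrow> gen_fun S' q \<le> gen_fun S q"
    by (auto simp: eventually_at_left_field)
  then show "S' \<preceq> S"
    unfolding germ_le_def by (intro exI[of _ "1 - b"]) auto
qed

theorem proposition11:
  fixes k :: nat and S :: "nat set"
  assumes "k > 0"
  shows "is_winner {2, 4, 6 * k + 1} S \<longleftrightarrow> S = set_of_bits (winner_bits k)"
proof
  let ?W = "set_of_bits (winner_bits k)"
  assume S: "is_winner {2, 4, 6 * k + 1} S"
  then have "?W \<preceq> S" using avoiding_winner unfolding is_winner_def by blast
  show "S = ?W"
  proof (rule ccontr)
    assume "S \<noteq> ?W"
    then have "eventually (\<lambda>q. gen_fun S q < gen_fun ?W q) (at_left 1)"
      using S gen_fun_less_winner unfolding is_winner_def by blast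
    moreover have "eventually (\<lambda>q. gen_fun ?W q \<le> gen_fun S q) (at_left 1)"
      using \<open>?W \<preceq> S\<close> by (simp add: germ_le_iff_eventually)
    ultimately have "eventually (\<lambda>q::real. False) (at_left 1)"
      by eventually_elim simp
    then show False by simp
  qed
next
  assume W: "S = set_of_bits (winner_bits k)"
  have "S' \<preceq> S" if "avoiding {2, 4, 6 * k + 1} S'" for S'
  proof (cases "S' = S")
    case False
    then have "eventually (\<lambda>q. gen_fun S' q < gen_fun S q) (at_left 1)"
      using gen_fun_less_winner[OF that] W by simp
    then show ?thesis
      unfolding germ_le_iff_eventually by eventually_elim simp
  qed (simp add: germ_le_iff_eventually)
  then show "is_winner {2, 4, 6 * k + 1} S"
    using avoiding_winner W unfolding is_winner_def by blast
qed

end
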